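(* Let $\mathbb{F}$ be a field, let $\epsilon,\eta\ge0$ and $p,m\ge1$ be integers, let $\lambda M_1+M_0\in\mathbb{F}[\lambda]^{(\eta+1)p\times(\epsilon+1)m}$ be an arbitrary pencil, let $Y\in\mathbb{F}^{\epsilon m\times\epsilon m}$ and $Z\in\mathbb{F}^{\eta p\times\eta p}$, and let $$C_{EK}(\lambda)=\begin{bmatrix}\lambda M_1+M_0&(Z(L_\eta(\lambda)\otimes I_p))^T\\ Y(L_\epsilon(\lambda)\otimes I_m)&0\end{bmatrix}$$ be the corresponding extended block Kronecker pencil. Let $$P(\lambda):=(\Lambda_\eta(\lambda)^T\otimes I_p)(\lambda M_1+M_0)(\Lambda_\epsilon(\lambda)\otimes I_m)\in\mathbb{F}[\lambda]^{p\times m}.$$ Partition $L_\epsilon(\lambda)\otimes I_m=\begin{bmatrix}A_{\epsilon,m}(\lambda)&B_{\epsilon,m}(\lambda)\end{bmatrix}$ and $L_\eta(\lambda)\otimes I_p=\begin{bmatrix}A_{\eta,p}(\lambda)&B_{\eta,p}(\lambda)\end{bmatrix}$, where $A_{\epsilon,m}(\lambda)$ is $\epsilon m\times\epsilon m$ and $A_{\eta,p}(\lambda)$ is $\eta p\times\eta p$, and correspondingly $$C_{EK}(\lambda)=\begin{bmatrix}M_{11}(\lambda)&M_{12}(\lambda)&A_{\eta,p}(\lambda)^TZ^T\\ M_{21}(\lambda)&M_{22}(\lambda)&B_{\eta,p}(\lambda)^TZ^T\\ Y A_{\epsilon,m}(\lambda)&Y B_{\epsilon,m}(\lambda)&0\end{bmatrix},$$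 where $M_{11}(\lambda)$ is $\eta p\times\epsilon m$ and $M_{22}(\lambda)$ is $p\times m$. Assume that $Y$ and $Z$ are invertible. Then the following statements hold: (a) The submatrix $\widetilde A(\lambda):=\begin{bmatrix}M_{11}(\lambda)&A_{\eta,p}(\lambda)^TZ^T\\ Y A_{\epsilon,m}(\lambda)&0\end{bmatrix}$ of $C_{EK}(\lambda)$ is unimodular. (b) The Schur complement of $\widetilde A(\lambda)$ in $C_{EK}(\lambda)$, i.e. $\widetilde D(\lambda)+\widetilde C(\lambda)\widetilde A(\lambda)^{-1}\widetilde B(\lambda)$ with $\widetilde B(\lambda):=\begin{bmatrix}M_{12}(\lambda)\\ Y B_{\epsilon,m}(\lambda)\end{bmatrix}$, $\widetilde C(\lambda):=-\begin{bmatrix}M_{21}(\lambda)&B_{\eta,p}(\lambda)^TZ^T\end{bmatrix}$ and $\widetilde D(\lambda):=M_{22}(\lambda)$, is the polynomial matrix $P(\lambda)$. (c) $C_{EK}(\lambda)$ is a linearization of $P(\lambda)$.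
   Context: $\mathbb{F}$ is an arbitrary field; $\otimes$ is the Kronecker product. A pencil is a polynomial matrix of degree at most $1$. A unimodular matrix is a square polynomial matrix whose determinant is a nonzero constant. For $k\ge0$, $$L_k(\lambda):=\begin{bmatrix}-1&\lambda\\ &-1&\lambda\\ &&\ddots&\ddots\\ &&&-1&\lambda\end{bmatrix}\in\mathbb{F}[\lambda]^{k\times(k+1)},\qquad\Lambda_k(\lambda):=\begin{bmatrix}\lambda^k&\lambda^{k-1}&\cdots&\lambda&1\end{bmatrix}^T.$$ The cases $\epsilon=0$ or $\eta=0$ (second block row, respectively second block column, of $C_{EK}(\lambda)$ empty) are included; the corresponding blocks are then empty. A linearization of $P(\lambda)\in\mathbb{F}[\lambda]^{p\times m}$ is a pencil $L(\lambda)$ for which there exist unimodular matrices $U_1(\lambda),V_1(\lambda)$ and an integer $s\ge0$ with $U_1(\lambda)L(\lambda)V_1(\lambda)=\begin{bmatrix}P(\lambda)&0\\ 0&I_s\end{bmatrix}$. *)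

theory Defs
  imports "Jordan_Normal_Form.Determinant"
begin

text \<open>The indeterminate \<open>\<lambda>\<close> is the polynomial \<open>[:0, 1:]\<close>; a polynomial matrix over the
  field \<open>'a\<close> is an \<open>'a poly mat\<close>.\<close>

definition const_mat :: "'a :: zero mat \<Rightarrow> 'a poly mat" where
  "const_mat A = map_mat (\<lambda>c. [:c:]) A"

definition pencil :: "'a :: comm_ring_1 mat \<Rightarrow> 'a mat \<Rightarrow> 'a poly mat" where
  "pencil M1 M0 = [:0, 1:] \<cdot>\<^sub>m const_mat M1 + const_mat M0"

definition is_pencil :: "'a :: zero poly mat \<Rightarrow> bool" where
  "is_pencil A \<longleftrightarrow> (\<forall>i < dim_row A. \<forall>j < dim_col A. degree (A $$ (i, j)) \<le> 1)"

definition unimodular :: "'a :: field poly mat \<Rightarrow> bool" where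
  "unimodular A \<longleftrightarrow> square_mat A \<and> (\<exists>c. c \<noteq> 0 \<and> det A = [:c:])"

definition kron :: "'a :: times mat \<Rightarrow> 'a mat \<Rightarrow> 'a mat" where
  "kron A B = mat (dim_row A * dim_row B) (dim_col A * dim_col B)
     (\<lambda>(i, j). A $$ (i div dim_row B, j div dim_col B) * B $$ (i mod dim_row B, j mod dim_col B))"

definition L_pencil :: "nat \<Rightarrow> 'a :: comm_ring_1 poly mat" where
  "L_pencil k = mat k (k + 1)
     (\<lambda>(i, j). if j = i then -1 else if j = i + 1 then [:0, 1:] else 0)"

definition Lambda_col :: "nat \<Rightarrow> 'a :: comm_ring_1 poly mat" where
  "Lambda_col k = mat (k + 1) 1 (\<lambda>(i, j). [:0, 1:] ^ (k - i))"

text \<open>The column counterpart of \<^const>\<open>append_rows\<close>.\<close>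

definition append_cols :: "'a :: zero mat \<Rightarrow> 'a mat \<Rightarrow> 'a mat" (infixr \<open>@\<^sub>c\<close> 65) where
  "A @\<^sub>c B = four_block_mat A B (0\<^sub>m 0 (dim_col A)) (0\<^sub>m 0 (dim_col B))"

text \<open>The inverse is taken in the polynomial matrices. It is meaningful for the invertible ones only,
  which include the unimodular ones (\<open>mat_inv_unimodular\<close> below).\<close>

definition mat_inv :: "'a :: semiring_1 mat \<Rightarrow> 'a mat" where
  "mat_inv A = (THE B. inverts_mat A B \<and> inverts_mat B A)"

definition extended_block_kronecker ::
  "nat \<Rightarrow> nat \<Rightarrow> nat \<Rightarrow> nat \<Rightarrow> 'a :: field mat \<Rightarrow> 'a mat \<Rightarrow> 'a mat \<Rightarrow> 'a mat \<Rightarrow> 'a poly mat" where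
  "extended_block_kronecker \<epsilon> \<eta> p m M1 M0 Y Z = four_block_mat
     (pencil M1 M0) (transpose_mat (const_mat Z * kron (L_pencil \<eta>) (1\<^sub>m p)))
     (const_mat Y * kron (L_pencil \<epsilon>) (1\<^sub>m m)) (0\<^sub>m (\<epsilon> * m) (\<eta> * p))"

text \<open>The carrier conditions are needed because the product of matrices of mismatched dimensions
  is still a (meaningless) matrix.\<close>

definition is_linearization :: "'a :: field poly mat \<Rightarrow> 'a poly mat \<Rightarrow> bool" where
  "is_linearization L P \<longleftrightarrow> is_pencil L \<and>
     (\<exists>U V s. U \<in> carrier_mat (dim_row L) (dim_row L) \<and> V \<in> carrier_mat (dim_col L) (dim_col L) \<and>
        unimodular U \<and> unimodular V \<and>
        U * L * V = four_block_mat P (0\<^sub>m (dim_row P) s) (0\<^sub>m s (dim_col P)) (1\<^sub>m s))"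

lemma mat_inv_eqI:
  fixes A :: "'a :: comm_ring_1 mat"
  assumes A: "A \<in> carrier_mat n n" and B: "B \<in> carrier_mat n n"
    and AB: "A * B = 1\<^sub>m n" and BA: "B * A = 1\<^sub>m n"
  shows "mat_inv A = B"
  unfolding mat_inv_def
proof (rule the_equality)
  show "inverts_mat A B \<and> inverts_mat B A"
    using assms by (simp add: inverts_mat_def)
next
  fix X assume X: "inverts_mat A X \<and> inverts_mat X A"
  then have AX: "A * X = 1\<^sub>m n" and XA: "X * A = 1\<^sub>m (dim_row X)"
    using A by (simp_all add: inverts_mat_def)
  have "dim_col X = n" using arg_cong[OF AX, of dim_col] by simp
  moreover have "dim_row X = n" using arg_cong[OF XA, of dim_col] A by simp
  ultimately have Xc: "X \<in> carrier_mat n n" by auto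
  have "X = (B * A) * X" using Xc BA by simp
  also have "\<dots> = B * (A * X)" by (rule assoc_mult_mat[OF B A Xc])
  also have "\<dots> = B" using AX B by simp
  finally show "X = B" .
qed

lemma mat_inv_unimodular:
  fixes A :: "'a :: field poly mat"
  assumes A: "A \<in> carrier_mat n n" and u: "unimodular A"
  shows "mat_inv A \<in> carrier_mat n n" "A * mat_inv A = 1\<^sub>m n" "mat_inv A * A = 1\<^sub>m n"
proof -
  from u obtain c where c: "c \<noteq> 0" and d: "det A = [:c:]" by (auto simp: unimodular_def)
  define B where "B = [:inverse c:] \<cdot>\<^sub>m adj_mat A"
  note adj = adj_mat[OF A]
  have B: "B \<in> carrier_mat n n" using adj by (simp add: B_def)
  have one: "[:inverse c:] * det A = 1" using c d by (simp add: one_pCons)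
  have "A * B = ([:inverse c:] * det A) \<cdot>\<^sub>m 1\<^sub>m n"
    unfolding B_def mult_smult_distrib[OF A adj(1)] adj(2) by (rule eq_matI) auto
  with one have AB: "A * B = 1\<^sub>m n" by (auto intro: eq_matI)
  have "B * A = ([:inverse c:] * det A) \<cdot>\<^sub>m 1\<^sub>m n"
    unfolding B_def mult_smult_assoc_mat[OF adj(1) A] adj(3) by (rule eq_matI) auto
  with one have BA: "B * A = 1\<^sub>m n" by (auto intro: eq_matI)
  note inv = mat_inv_eqI[OF A B AB BA]
  show "mat_inv A \<in> carrier_mat n n" "A * mat_inv A = 1\<^sub>m n" "mat_inv A * A = 1\<^sub>m n"
    using inv B AB BA by auto
qed

lemma append_cols_index:
  assumes "A \<in> carrier_mat n k" "B \<in> carrier_mat n l" "i < n" "j < k + l"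
  shows "(A @\<^sub>c B) $$ (i, j) = (if j < k then A $$ (i, j) else B $$ (i, j - k))"
  using assms by (auto simp: append_cols_def)

lemma append_cols_carrier:
  assumes "A \<in> carrier_mat n k" "B \<in> carrier_mat n l"
  shows "A @\<^sub>c B \<in> carrier_mat n (k + l)"
  using assms by (auto simp: append_cols_def)

lemma mult_append_cols:
  fixes C :: "'a :: comm_ring_1 mat"
  assumes "C \<in> carrier_mat r n" "A \<in> carrier_mat n k" "B \<in> carrier_mat n l"
  shows "C * (A @\<^sub>c B) = (C * A) @\<^sub>c (C * B)"
proof (rule eq_matI)
  note car = append_cols_carrier[OF assms(2,3)]
    append_cols_carrier[OF mult_carrier_mat[OF assms(1,2)] mult_carrier_mat[OF assms(1,3)]]
  show "dim_row (C * (A @\<^sub>c B)) = dim_row ((C * A) @\<^sub>c (C * B))"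
    "dim_col (C * (A @\<^sub>c B)) = dim_col ((C * A) @\<^sub>c (C * B))"
    using car assms by auto
  fix i j assume "i < dim_row ((C * A) @\<^sub>c (C * B))" "j < dim_col ((C * A) @\<^sub>c (C * B))"
  then have ij: "i < r" "j < k + l" using car by auto
  show "(C * (A @\<^sub>c B)) $$ (i, j) = ((C * A) @\<^sub>c (C * B)) $$ (i, j)"
    using ij assms car
    by (subst append_cols_index[OF mult_carrier_mat[OF assms(1,2)] mult_carrier_mat[OF assms(1,3)]])
       (auto simp: scalar_prod_def append_cols_index[OF assms(2,3)] intro!: sum.cong)
qed

lemma block_layout:
  fixes M11 :: "'a :: zero mat"
  assumes c: "M11 \<in> carrier_mat h e" "M12 \<in> carrier_mat h m"
    "M21 \<in> carrier_mat p e" "M22 \<in> carrier_mat p m"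
    "U \<in> carrier_mat e e" "V \<in> carrier_mat e m"
    "S \<in> carrier_mat h h" "T \<in> carrier_mat h p"
  shows "four_block_mat (four_block_mat M11 M12 M21 M22) (transpose_mat (S @\<^sub>c T)) (U @\<^sub>c V) (0\<^sub>m e h)
    = (M11 @\<^sub>c M12 @\<^sub>c transpose_mat S) @\<^sub>r (M21 @\<^sub>c M22 @\<^sub>c transpose_mat T)
      @\<^sub>r (U @\<^sub>c V @\<^sub>c 0\<^sub>m e h)" (is "?l = ?r")
proof (rule eq_matI)
  have d: "dim_row M11 = h" "dim_col M11 = e" "dim_row M12 = h" "dim_col M12 = m"
    "dim_row M21 = p" "dim_col M21 = e" "dim_row M22 = p" "dim_col M22 = m"
    "dim_row U = e" "dim_col U = e" "dim_row V = e" "dim_col V = m"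
    "dim_row S = h" "dim_col S = h" "dim_row T = h" "dim_col T = p"
    using c by auto
  show "dim_row ?l = dim_row ?r" "dim_col ?l = dim_col ?r"
    by (simp_all add: append_cols_def append_rows_def d)
  fix i j assume "i < dim_row ?r" "j < dim_col ?r"
  then have i: "i < h + (p + e)" and j: "j < e + (m + h)"
    by (simp_all add: append_cols_def append_rows_def d)
  consider "i < h" | "\<not> i < h" "i - h < p" "i < h + p" | "\<not> i < h" "\<not> i - h < p" "\<not> i < h + p" "i - (h + p) < e" "i - h - p = i - (h + p)"
    using i by linarith
  then show "?l $$ (i, j) = ?r $$ (i, j)"
  proof cases
    case 1
    note i' = this
    consider "j < e" | "\<not> j < e" "j - e < m" "j < e + m" | "\<not> j < e" "\<not> j - e < m" "\<not> j < e + m" "j - (e + m) < h" "j - e - m = j - (e + m)"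
      using j by linarith
    then show ?thesis
      by cases (use i j i' in \<open>simp_all add: append_cols_def append_rows_def d\<close>)
  next
    case 2
    note i' = this
    consider "j < e" | "\<not> j < e" "j - e < m" "j < e + m" | "\<not> j < e" "\<not> j - e < m" "\<not> j < e + m" "j - (e + m) < h" "j - e - m = j - (e + m)"
      using j by linarith
    then show ?thesis
      by cases (use i j i' in \<open>simp_all add: append_cols_def append_rows_def d\<close>)
  next
    case 3
    note i' = this
    consider "j < e" | "\<not> j < e" "j - e < m" "j < e + m" | "\<not> j < e" "\<not> j - e < m" "\<not> j < e + m" "j - (e + m) < h" "j - e - m = j - (e + m)"
      using j by linarith
    then show ?thesis
      by cases (use i j i' in \<open>simp_all add: append_cols_def append_rows_def d\<close>)
  qed
qed

text \<open>The block layout of the pencil induced by the partition of its blocks.\<close>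

lemma extended_block_kronecker_layout:
  fixes M1 M0 Y Z :: "'a :: field mat"
  assumes Y: "Y \<in> carrier_mat (\<epsilon> * m) (\<epsilon> * m)" and Z: "Z \<in> carrier_mat (\<eta> * p) (\<eta> * p)"
    and A1: "A1 \<in> carrier_mat (\<epsilon> * m) (\<epsilon> * m)" and B1: "B1 \<in> carrier_mat (\<epsilon> * m) m"
    and L1: "kron (L_pencil \<epsilon>) (1\<^sub>m m) = A1 @\<^sub>c B1"
    and A2: "A2 \<in> carrier_mat (\<eta> * p) (\<eta> * p)" and B2: "B2 \<in> carrier_mat (\<eta> * p) p"
    and L2: "kron (L_pencil \<eta>) (1\<^sub>m p) = A2 @\<^sub>c B2"
    and M11: "M11 \<in> carrier_mat (\<eta> * p) (\<epsilon> * m)" and M12: "M12 \<in> carrier_mat (\<eta> * p) m"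
    and M21: "M21 \<in> carrier_mat p (\<epsilon> * m)" and M22: "M22 \<in> carrier_mat p m"
    and M: "pencil M1 M0 = four_block_mat M11 M12 M21 M22"
  shows "extended_block_kronecker \<epsilon> \<eta> p m M1 M0 Y Z =
      (M11 @\<^sub>c M12 @\<^sub>c (transpose_mat A2 * transpose_mat (const_mat Z)))
   @\<^sub>r (M21 @\<^sub>c M22 @\<^sub>c (transpose_mat B2 * transpose_mat (const_mat Z)))
   @\<^sub>r ((const_mat Y * A1) @\<^sub>c (const_mat Y * B1) @\<^sub>c 0\<^sub>m (\<epsilon> * m) (\<eta> * p))"
proof -
  let ?Y = "const_mat Y" and ?Z = "const_mat Z"
  have Yc: "?Y \<in> carrier_mat (\<epsilon> * m) (\<epsilon> * m)" using Y by (simp add: const_mat_def)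
  have Zc: "?Z \<in> carrier_mat (\<eta> * p) (\<eta> * p)" using Z by (simp add: const_mat_def)
  define U where "U = ?Y * A1"
  define V where "V = ?Y * B1"
  define S where "S = ?Z * A2"
  define T where "T = ?Z * B2"
  have c: "U \<in> carrier_mat (\<epsilon> * m) (\<epsilon> * m)" "V \<in> carrier_mat (\<epsilon> * m) m"
    "S \<in> carrier_mat (\<eta> * p) (\<eta> * p)" "T \<in> carrier_mat (\<eta> * p) p"
    using Yc Zc A1 B1 A2 B2 by (simp_all add: U_def V_def S_def T_def)
  have t: "transpose_mat A2 * transpose_mat ?Z = transpose_mat S"
    "transpose_mat B2 * transpose_mat ?Z = transpose_mat T"
    unfolding S_def T_def using transpose_mult[OF Zc A2] transpose_mult[OF Zc B2] by simp_all
  have K: "?Y * kron (L_pencil \<epsilon>) (1\<^sub>m m) = U @\<^sub>c V" "?Z * kron (L_pencil \<eta>) (1\<^sub>m p) = S @\<^sub>c T"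
    unfolding L1 L2 U_def V_def S_def T_def
    using mult_append_cols[OF Yc A1 B1] mult_append_cols[OF Zc A2 B2] by simp_all
  show ?thesis
    unfolding extended_block_kronecker_def K M t U_def[symmetric] V_def[symmetric]
    by (rule block_layout[OF M11 M12 M21 M22 c])
qed

end

theory Submission
  imports Defs
begin

text \<open>Write \<open>A\<close>, \<open>B\<close> for the two blocks of \<open>L\<^sub>k \<otimes> I\<^sub>n\<close>. Two facts about this pencil carry the
  proof. First, its leading block \<open>A\<close> is upper triangular with diagonal entries \<open>-1\<close>, so \<open>A\<close> is
  unimodular (\<open>unimodular_kron_L_pencil_block\<close>). Second, \<open>L\<^sub>k \<Lambda>\<^sub>k = 0\<close>, and the last block of
  \<open>\<Lambda>\<^sub>k \<otimes> I\<^sub>n\<close> is \<open>I\<^sub>n\<close>; calling the remaining blocks \<open>E\<close>, the mixed product rule for Kronecker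
  products turns this into \<open>B = - A E\<close> (\<open>kron_L_pencil_split\<close>).

  Put \<open>U = Y A\<^sub>\<epsilon>\<close>, \<open>V = Y B\<^sub>\<epsilon>\<close>, \<open>X = A\<^sub>\<eta>\<^sup>T Z\<^sup>T\<close> and \<open>W = B\<^sub>\<eta>\<^sup>T Z\<^sup>T\<close>. Then \<open>U\<close> and \<open>X\<close> are unimodular,
  \<open>V = - U E\<close> and \<open>W = - G X\<close>, where \<open>G\<close> is the transpose of the block \<open>E\<close> belonging to \<open>\<eta>\<close>.
  The matrix with block rows \<open>M11, X\<close> and \<open>U, 0\<close> is block antitriangular with unimodular
  antidiagonal, hence unimodular (\<open>unimodular_block_antitriangular\<close>), which is (a). Both outer factors
  of \<open>P\<close> are now explicit, \<open>P = [G I] M [E; I]\<close>, and eliminating \<open>V\<close> by \<open>E\<close> and \<open>W\<close> by \<open>G\<close> yields the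
  same expression for the Schur complement (\<open>schur_complement_block_antitriangular\<close>), which is (b).

  For (c), interchanging the first two block rows and the first two block columns of the pencil
  moves \<open>M22\<close> to the upper left corner and the unimodular submatrix to the lower right one
  (\<open>swap_three_block_matrix\<close>). Since that submatrix has a polynomial inverse, block elimination is
  carried out by unimodular factors and leaves the Schur complement next to an identity
  (\<open>schur_complement_equivalence\<close>).\<close>

section \<open>Block rows and block columns\<close>

lemma transpose_append_cols:
  assumes "A \<in> carrier_mat n k" "B \<in> carrier_mat n l"
  shows "transpose_mat (A @\<^sub>c B) = transpose_mat A @\<^sub>r transpose_mat B"
  by (rule eq_matI) (use assms in \<open>auto simp: append_cols_def append_rows_def\<close>)

lemma append_cols_mult_append_rows:
  fixes A :: "'a :: comm_ring_1 mat"
  assumes A: "A \<in> carrier_mat r k" and B: "B \<in> carrier_mat r l"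
    and C: "C \<in> carrier_mat k c" and D: "D \<in> carrier_mat l c"
  shows "(A @\<^sub>c B) * (C @\<^sub>r D) = A * C + B * D"
proof -
  have "(A @\<^sub>c B) * (C @\<^sub>r D)
      = four_block_mat A B (0\<^sub>m 0 k) (0\<^sub>m 0 l) * four_block_mat C (0\<^sub>m k 0) D (0\<^sub>m l 0)"
    using assms by (auto simp: append_cols_def append_rows_def)
  also have "\<dots> = four_block_mat (A * C + B * D) (A * 0\<^sub>m k 0 + B * 0\<^sub>m l 0)
      (0\<^sub>m 0 k * C + 0\<^sub>m 0 l * D) (0\<^sub>m 0 k * 0\<^sub>m k 0 + 0\<^sub>m 0 l * 0\<^sub>m l 0)"
    by (rule mult_four_block_mat) (use assms in auto)
  also have "\<dots> = A * C + B * D"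
    by (rule eq_matI) (use assms in auto)
  finally show ?thesis .
qed

lemma four_block_mult_append_rows:
  fixes A :: "'a :: comm_ring_1 mat"
  assumes A: "A \<in> carrier_mat r k" and B: "B \<in> carrier_mat r l"
    and C: "C \<in> carrier_mat s k" and D: "D \<in> carrier_mat s l"
    and E: "E \<in> carrier_mat k c" and F: "F \<in> carrier_mat l c"
  shows "four_block_mat A B C D * (E @\<^sub>r F) = (A * E + B * F) @\<^sub>r (C * E + D * F)"
proof -
  have "four_block_mat A B C D * (E @\<^sub>r F)
      = four_block_mat A B C D * four_block_mat E (0\<^sub>m k 0) F (0\<^sub>m l 0)"
    using E F by (simp add: append_rows_def)
  also have "\<dots> = four_block_mat (A * E + B * F) (A * 0\<^sub>m k 0 + B * 0\<^sub>m l 0)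
      (C * E + D * F) (C * 0\<^sub>m k 0 + D * 0\<^sub>m l 0)"
    by (rule mult_four_block_mat) (use assms in auto)
  also have "\<dots> = (A * E + B * F) @\<^sub>r (C * E + D * F)"
    by (rule eq_matI) (use assms in \<open>auto simp: append_rows_def\<close>)
  finally show ?thesis .
qed

lemma append_cols_mult_four_block:
  fixes A :: "'a :: comm_ring_1 mat"
  assumes E: "E \<in> carrier_mat r k" and F: "F \<in> carrier_mat r l"
    and A: "A \<in> carrier_mat k c" and B: "B \<in> carrier_mat k d"
    and C: "C \<in> carrier_mat l c" and D: "D \<in> carrier_mat l d"
  shows "(E @\<^sub>c F) * four_block_mat A B C D = (E * A + F * C) @\<^sub>c (E * B + F * D)"
proof -
  have "(E @\<^sub>c F) * four_block_mat A B C D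
      = four_block_mat E F (0\<^sub>m 0 k) (0\<^sub>m 0 l) * four_block_mat A B C D"
    using E F by (simp add: append_cols_def)
  also have "\<dots> = four_block_mat (E * A + F * C) (E * B + F * D)
      (0\<^sub>m 0 k * A + 0\<^sub>m 0 l * C) (0\<^sub>m 0 k * B + 0\<^sub>m 0 l * D)"
    by (rule mult_four_block_mat) (use assms in auto)
  also have "\<dots> = (E * A + F * C) @\<^sub>c (E * B + F * D)"
    by (rule eq_matI) (use assms in \<open>auto simp: append_cols_def\<close>)
  finally show ?thesis .
qed

lemma uminus_append_rows:
  fixes A :: "'a :: ab_group_add mat"
  assumes "A \<in> carrier_mat k n" "B \<in> carrier_mat l n"
  shows "- (A @\<^sub>r B) = (- A) @\<^sub>r (- B)"
  by (rule eq_matI) (use assms in \<open>auto simp: append_rows_def\<close>)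

lemma uminus_r_inv_mat:
  "A \<in> carrier_mat n k \<Longrightarrow> A + - A = (0\<^sub>m n k :: 'a :: ab_group_add mat)"
  by (rule eq_matI) auto

lemma uminus_zero_mat: "- 0\<^sub>m n k = (0\<^sub>m n k :: 'a :: ab_group_add mat)"
  by (rule eq_matI) auto

text \<open>The same \<open>3 \<times> 3\<close> block matrix, bracketed first as \<open>(2 + 1) \<times> (2 + 1)\<close> and then as
  \<open>(1 + 2) \<times> (1 + 2)\<close>. The first bracketing is the one in which the pencil is given, the second
  exhibits the block that is to be inverted.\<close>

lemma three_block_regroup:
  fixes M11 :: "'a :: zero mat"
  assumes "M11 \<in> carrier_mat h e" "M12 \<in> carrier_mat h m"
    "M21 \<in> carrier_mat p e" "M22 \<in> carrier_mat p m"
    "U \<in> carrier_mat e e" "V \<in> carrier_mat e m"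
    "X \<in> carrier_mat h h" "W \<in> carrier_mat p h"
  shows "four_block_mat (four_block_mat M22 M21 M12 M11) (W @\<^sub>r X) (V @\<^sub>c U) (0\<^sub>m e h)
       = four_block_mat M22 (M21 @\<^sub>c W) (M12 @\<^sub>r V) (four_block_mat M11 X U (0\<^sub>m e h))"
    (is "?l = ?r")
proof (rule eq_matI)
  have d: "dim_row M11 = h" "dim_col M11 = e" "dim_row M12 = h" "dim_col M12 = m"
    "dim_row M21 = p" "dim_col M21 = e" "dim_row M22 = p" "dim_col M22 = m"
    "dim_row U = e" "dim_col U = e" "dim_row V = e" "dim_col V = m"
    "dim_row X = h" "dim_col X = h" "dim_row W = p" "dim_col W = h"
    using assms by auto
  show "dim_row ?l = dim_row ?r" "dim_col ?l = dim_col ?r"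
    by (simp_all add: append_cols_def append_rows_def d)
  fix i j assume "i < dim_row ?r" "j < dim_col ?r"
  then have i: "i < p + (h + e)" and j: "j < m + (e + h)"
    by (simp_all add: append_cols_def append_rows_def d)
  consider "i < p" | "\<not> i < p" "i < p + h" "i - p < h"
    | "\<not> i < p" "\<not> i < p + h" "\<not> i - p < h" "i - (p + h) < e" "i - p - h = i - (p + h)"
    using i by linarith
  note rows = this
  consider "j < m" | "\<not> j < m" "j < m + e" "j - m < e"
    | "\<not> j < m" "\<not> j < m + e" "\<not> j - m < e" "j - (m + e) < h" "j - m - e = j - (m + e)"
    using j by linarith
  then show "?l $$ (i, j) = ?r $$ (i, j)"
    by cases (use rows i j in \<open>cases; simp add: append_cols_def append_rows_def d\<close>)+
qed

section \<open>Unimodular matrices\<close>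

lemma unimodular_mult:
  assumes A: "A \<in> carrier_mat n n" and B: "B \<in> carrier_mat n n"
    and uA: "unimodular A" and uB: "unimodular B"
  shows "unimodular (A * B)"
proof -
  from uA uB obtain a b where "a \<noteq> 0" "det A = [:a:]" "b \<noteq> 0" "det B = [:b:]"
    by (auto simp: unimodular_def)
  with det_mult[OF A B] have "det (A * B) = [:a * b:]" "a * b \<noteq> 0" by auto
  with A B show ?thesis unfolding unimodular_def by auto
qed

text \<open>The determinants of inverse polynomial matrices are units of the polynomial ring, and over a
  field the only units are the nonzero constants.\<close>

lemma unimodular_if_inverse:
  fixes A :: "'a :: field poly mat"
  assumes A: "A \<in> carrier_mat n n" and B: "B \<in> carrier_mat n n" and AB: "A * B = 1\<^sub>m n"
  shows "unimodular A" "unimodular B"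
proof -
  have "det A * det B = 1"
    using det_mult[OF A B] AB by simp
  then have "det A dvd 1" "det B dvd 1"
    by (metis dvd_triv_left dvd_triv_right)+
  then show "unimodular A" "unimodular B"
    using A B by (auto simp: unimodular_def is_unit_poly_iff)
qed

lemma unimodular_transpose:
  assumes "A \<in> carrier_mat n n" "unimodular A"
  shows "unimodular (transpose_mat A)"
  using assms det_transpose[OF assms(1)] by (auto simp: unimodular_def)

lemma unimodular_diag_block:
  assumes A: "A \<in> carrier_mat n n" and uA: "unimodular A"
  shows "unimodular (four_block_mat A (0\<^sub>m n k) (0\<^sub>m k n) (1\<^sub>m k))"
proof -
  have "det (four_block_mat A (0\<^sub>m n k) (0\<^sub>m k n) (1\<^sub>m k)) = det A"
    using det_four_block_mat_lower_left_zero[OF A zero_carrier_mat refl one_carrier_mat] by simp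
  with A uA show ?thesis by (auto simp: unimodular_def)
qed

lemma unimodular_const_mat:
  fixes A :: "'a :: field mat"
  assumes A: "A \<in> carrier_mat n n" and inv: "invertible_mat A"
  shows "unimodular (const_mat A)"
proof -
  interpret c: comm_ring_hom "\<lambda>c :: 'a. [:c:]"
    by unfold_locales (auto simp: one_pCons)
  from inv obtain B where AB: "A * B = 1\<^sub>m n" and BA: "B * A = 1\<^sub>m (dim_row B)"
    using A by (auto simp: invertible_mat_def inverts_mat_def)
  have B: "B \<in> carrier_mat n n"
    using arg_cong[OF AB, of dim_col] arg_cong[OF BA, of dim_col] A by auto
  have "const_mat A * const_mat B = 1\<^sub>m n"
    unfolding const_mat_def c.mat_hom_mult[OF A B, symmetric] AB c.mat_hom_one ..
  with A B show ?thesis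
    by (intro unimodular_if_inverse(1)[of _ n "const_mat B"]) (auto simp: const_mat_def)
qed

text \<open>The inverse can be written down, with block rows \<open>0, U\<^sup>-\<^sup>1\<close> and \<open>X\<^sup>-\<^sup>1, - X\<^sup>-\<^sup>1 N U\<^sup>-\<^sup>1\<close>.
  This avoids evaluating a determinant whose diagonal blocks need not be square.\<close>

lemma unimodular_block_antitriangular:
  fixes X U :: "'a :: field poly mat"
  assumes N: "N \<in> carrier_mat h e" and X: "X \<in> carrier_mat h h" and U: "U \<in> carrier_mat e e"
    and uX: "unimodular X" and uU: "unimodular U"
  shows "unimodular (four_block_mat N X U (0\<^sub>m e h))"
proof -
  note iX = mat_inv_unimodular[OF X uX] and iU = mat_inv_unimodular[OF U uU]
  let ?A = "four_block_mat N X U (0\<^sub>m e h)"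
  let ?B = "four_block_mat (0\<^sub>m e h) (mat_inv U) (mat_inv X) (- (mat_inv X * (N * mat_inv U)))"
  have NU: "N * mat_inv U \<in> carrier_mat h e" using N iU by simp
  have XXN: "X * (- (mat_inv X * (N * mat_inv U))) = - (N * mat_inv U)"
    using X iX NU by (simp add: assoc_mult_mat[OF X iX(1) NU, symmetric] left_mult_one_mat[OF NU])
  have "?A * ?B = four_block_mat (N * 0\<^sub>m e h + X * mat_inv X)
      (N * mat_inv U + X * (- (mat_inv X * (N * mat_inv U))))
      (U * 0\<^sub>m e h + 0\<^sub>m e h * mat_inv X)
      (U * mat_inv U + 0\<^sub>m e h * (- (mat_inv X * (N * mat_inv U))))"
    by (rule mult_four_block_mat) (use N X U iX iU in auto)
  also have "\<dots> = 1\<^sub>m (h + e)"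
    unfolding XXN using N X U iX iU NU
    by (simp add: uminus_r_inv_mat[OF NU] uminus_zero_mat flip: four_block_one_mat)
  finally have "?A * ?B = 1\<^sub>m (h + e)" .
  moreover have "?A \<in> carrier_mat (h + e) (h + e)"
    using N X U by (auto intro!: carrier_matI)
  moreover have "?B \<in> carrier_mat (h + e) (h + e)"
    using N X U iX iU by (auto intro!: carrier_matI)
  ultimately show ?thesis by (rule unimodular_if_inverse(1)[rotated 2])
qed

text \<open>Multiplication from the left interchanges block rows of heights \<open>a\<close> and \<open>b\<close>, in this order;
  multiplication from the right interchanges block columns of widths \<open>b\<close> and \<open>a\<close>.\<close>

definition swap_blocks_mat :: "nat \<Rightarrow> nat \<Rightarrow> 'a :: {zero, one} mat" where
  "swap_blocks_mat a b = four_block_mat (0\<^sub>m b a) (1\<^sub>m b) (1\<^sub>m a) (0\<^sub>m a b)"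

lemma swap_blocks_mat_carrier: "swap_blocks_mat a b \<in> carrier_mat (a + b) (a + b)"
  by (rule carrier_matI) (auto simp: swap_blocks_mat_def)

lemma unimodular_swap_blocks_mat: "unimodular (swap_blocks_mat a b :: 'a :: field poly mat)"
proof -
  let ?A = "swap_blocks_mat a b :: 'a poly mat" and ?B = "swap_blocks_mat b a :: 'a poly mat"
  have "?A * ?B = four_block_mat (0\<^sub>m b a * 0\<^sub>m a b + 1\<^sub>m b * 1\<^sub>m b) (0\<^sub>m b a * 1\<^sub>m a + 1\<^sub>m b * 0\<^sub>m b a)
      (1\<^sub>m a * 0\<^sub>m a b + 0\<^sub>m a b * 1\<^sub>m b) (1\<^sub>m a * 1\<^sub>m a + 0\<^sub>m a b * 0\<^sub>m b a)"
    unfolding swap_blocks_mat_def by (rule mult_four_block_mat) auto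
  then have "?A * ?B = 1\<^sub>m (a + b)"
    by (simp add: add.commute)
  then show ?thesis
    using swap_blocks_mat_carrier[of b a, where 'a = "'a poly"]
    by (intro unimodular_if_inverse(1)[OF swap_blocks_mat_carrier]) (simp_all add: add.commute)
qed

section \<open>Schur complements\<close>

text \<open>Block Gaussian elimination with the lower right block as pivot. The off-diagonal blocks of the
  two factors involve \<open>A\<^sup>-\<^sup>1\<close>, so it is the unimodularity of \<open>A\<close> that keeps them polynomial. The sign
  of \<open>C\<close> is chosen so that the Schur complement appears with a plus sign.\<close>

lemma schur_complement_equivalence:
  fixes A :: "'a :: field poly mat"
  assumes A: "A \<in> carrier_mat n n" and B: "B \<in> carrier_mat n c"
    and C: "C \<in> carrier_mat r n" and D: "D \<in> carrier_mat r c" and uA: "unimodular A"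
  obtains U V where "U \<in> carrier_mat (r + n) (r + n)" "V \<in> carrier_mat (c + n) (c + n)"
    "unimodular U" "unimodular V"
    "U * four_block_mat D (- C) B A * V
     = four_block_mat (D + C * mat_inv A * B) (0\<^sub>m r n) (0\<^sub>m n c) (1\<^sub>m n)"
proof -
  note iA = mat_inv_unimodular[OF A uA]
  define S where "S = D + C * mat_inv A * B"
  let ?U = "four_block_mat (1\<^sub>m r) (C * mat_inv A) (0\<^sub>m n r) (mat_inv A)"
  let ?V = "four_block_mat (1\<^sub>m c) (0\<^sub>m c n) (- (mat_inv A * B)) (1\<^sub>m n)"
  have car: "C * mat_inv A \<in> carrier_mat r n" "mat_inv A * B \<in> carrier_mat n c"
    "C * mat_inv A * B \<in> carrier_mat r c" "S \<in> carrier_mat r c"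
    using A B C D iA by (auto simp: S_def)
  have CA: "C * mat_inv A * A = C"
    using assoc_mult_mat[OF C iA(1) A] iA C by simp
  have zC: "0\<^sub>m n r * (- C) = 0\<^sub>m n n"
    using C by (intro left_mult_zero_mat) auto
  have "?U * four_block_mat D (- C) B A
      = four_block_mat (1\<^sub>m r * D + C * mat_inv A * B) (1\<^sub>m r * (- C) + C * mat_inv A * A)
          (0\<^sub>m n r * D + mat_inv A * B) (0\<^sub>m n r * (- C) + mat_inv A * A)"
    by (rule mult_four_block_mat) (use A B C D iA car in auto)
  also have "\<dots> = four_block_mat S (0\<^sub>m r n) (mat_inv A * B) (1\<^sub>m n)"
    unfolding CA zC using A B C D iA car
    by (simp add: S_def uminus_l_inv_mat)
  finally have 1: "?U * four_block_mat D (- C) B A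
      = four_block_mat S (0\<^sub>m r n) (mat_inv A * B) (1\<^sub>m n)" .
  have "four_block_mat S (0\<^sub>m r n) (mat_inv A * B) (1\<^sub>m n) * ?V
      = four_block_mat (S * 1\<^sub>m c + 0\<^sub>m r n * (- (mat_inv A * B))) (S * 0\<^sub>m c n + 0\<^sub>m r n * 1\<^sub>m n)
          (mat_inv A * B * 1\<^sub>m c + 1\<^sub>m n * (- (mat_inv A * B))) (mat_inv A * B * 0\<^sub>m c n + 1\<^sub>m n * 1\<^sub>m n)"
    by (rule mult_four_block_mat) (use car in auto)
  also have "\<dots> = four_block_mat S (0\<^sub>m r n) (0\<^sub>m n c) (1\<^sub>m n)"
    using car A B iA by (simp add: uminus_r_inv_mat[OF car(2)] uminus_zero_mat)
  finally have 2: "?U * four_block_mat D (- C) B A * ?V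
      = four_block_mat S (0\<^sub>m r n) (0\<^sub>m n c) (1\<^sub>m n)"
    unfolding 1 .
  have uAi: "unimodular (mat_inv A)"
    by (rule unimodular_if_inverse(2)[OF A iA(1,2)])
  have "det ?U = det (mat_inv A)"
    using det_four_block_mat_lower_left_zero[OF one_carrier_mat car(1) refl iA(1)] by simp
  then have uU: "unimodular ?U"
    using uAi iA by (auto simp: unimodular_def)
  have "det ?V = 1"
    using det_four_block_mat_upper_right_zero[OF one_carrier_mat refl _ one_carrier_mat,
        of "- (mat_inv A * B)" n c] car by simp
  then have uV: "unimodular ?V"
    by (auto simp: unimodular_def one_pCons)
  show thesis
    by (rule that[OF _ _ uU uV 2[unfolded S_def]]) (use iA in auto)
qed

lemma swap_blocks_mult_append_rows:
  fixes A :: "'a :: comm_ring_1 mat"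
  assumes A: "A \<in> carrier_mat a n" and B: "B \<in> carrier_mat b n"
  shows "swap_blocks_mat a b * (A @\<^sub>r B) = B @\<^sub>r A"
  unfolding swap_blocks_mat_def using A B
  by (subst four_block_mult_append_rows[OF zero_carrier_mat one_carrier_mat one_carrier_mat
        zero_carrier_mat A B]) simp

lemma append_cols_mult_swap_blocks:
  fixes A :: "'a :: comm_ring_1 mat"
  assumes A: "A \<in> carrier_mat n b" and B: "B \<in> carrier_mat n a"
  shows "(A @\<^sub>c B) * swap_blocks_mat a b = B @\<^sub>c A"
  unfolding swap_blocks_mat_def using A B
  by (subst append_cols_mult_four_block[OF A B zero_carrier_mat one_carrier_mat one_carrier_mat
        zero_carrier_mat]) simp

lemma swap_blocks_four_block:
  fixes A :: "'a :: comm_ring_1 mat"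
  assumes A: "A \<in> carrier_mat h e" and B: "B \<in> carrier_mat h m"
    and C: "C \<in> carrier_mat p e" and D: "D \<in> carrier_mat p m"
  shows "swap_blocks_mat h p * four_block_mat A B C D * swap_blocks_mat m e = four_block_mat D C B A"
proof -
  have "swap_blocks_mat h p * four_block_mat A B C D = four_block_mat C D A B"
    unfolding swap_blocks_mat_def using assms
    by (subst mult_four_block_mat[OF zero_carrier_mat one_carrier_mat one_carrier_mat
          zero_carrier_mat A B C D]) simp
  moreover have "four_block_mat C D A B * swap_blocks_mat m e = four_block_mat D C B A"
    unfolding swap_blocks_mat_def using assms
    by (subst mult_four_block_mat[OF C D A B zero_carrier_mat one_carrier_mat one_carrier_mat
          zero_carrier_mat]) simp
  ultimately show ?thesis by simp
qed

text \<open>Interchanging the first two block rows and the first two block columns brings \<open>M11\<close>, \<open>X\<close>, \<open>U\<close>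
  and the zero block together, so that the Schur complement lemma applies.\<close>

lemma swap_three_block_matrix:
  fixes M11 :: "'a :: comm_ring_1 mat"
  assumes M: "M11 \<in> carrier_mat h e" "M12 \<in> carrier_mat h m"
    "M21 \<in> carrier_mat p e" "M22 \<in> carrier_mat p m"
    and U: "U \<in> carrier_mat e e" and V: "V \<in> carrier_mat e m"
    and X: "X \<in> carrier_mat h h" and W: "W \<in> carrier_mat p h"
  shows "four_block_mat (swap_blocks_mat h p) (0\<^sub>m (h + p) e) (0\<^sub>m e (h + p)) (1\<^sub>m e)
      * four_block_mat (four_block_mat M11 M12 M21 M22) (X @\<^sub>r W) (U @\<^sub>c V) (0\<^sub>m e h)
      * four_block_mat (swap_blocks_mat m e) (0\<^sub>m (m + e) h) (0\<^sub>m h (m + e)) (1\<^sub>m h)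
    = four_block_mat M22 (M21 @\<^sub>c W) (M12 @\<^sub>r V) (four_block_mat M11 X U (0\<^sub>m e h))"
    (is "?L * ?C * ?R = _")
proof -
  let ?M = "four_block_mat M11 M12 M21 M22"
  let ?S = "swap_blocks_mat h p :: 'a mat" and ?T = "swap_blocks_mat m e :: 'a mat"
  note S = swap_blocks_mat_carrier[of h p, where 'a = 'a]
    and T = swap_blocks_mat_carrier[of m e, where 'a = 'a]
  have Mc: "?M \<in> carrier_mat (h + p) (m + e)"
    using M by (auto intro!: carrier_matI)
  have XW: "X @\<^sub>r W \<in> carrier_mat (h + p) h" "W @\<^sub>r X \<in> carrier_mat (h + p) h"
    using X W carrier_append_rows[OF W X] by (auto simp: add.commute)
  have UV: "U @\<^sub>c V \<in> carrier_mat e (m + e)"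
    using append_cols_carrier[OF U V] by (simp add: add.commute)
  have VU: "V @\<^sub>c U \<in> carrier_mat e (m + e)" by (rule append_cols_carrier[OF V U])
  have "?L * ?C = four_block_mat (?S * ?M + 0\<^sub>m (h + p) e * (U @\<^sub>c V))
      (?S * (X @\<^sub>r W) + 0\<^sub>m (h + p) e * 0\<^sub>m e h)
      (0\<^sub>m e (h + p) * ?M + 1\<^sub>m e * (U @\<^sub>c V)) (0\<^sub>m e (h + p) * (X @\<^sub>r W) + 1\<^sub>m e * 0\<^sub>m e h)"
    by (rule mult_four_block_mat[OF S zero_carrier_mat zero_carrier_mat one_carrier_mat
          Mc XW(1) UV zero_carrier_mat])
  also have "\<dots> = four_block_mat (?S * ?M) (W @\<^sub>r X) (U @\<^sub>c V) (0\<^sub>m e h)"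
    using swap_blocks_mult_append_rows[OF X W] S XW UV mult_carrier_mat[OF S Mc]
      left_mult_zero_mat[OF Mc, of e] by simp
  finally have 1: "?L * ?C = four_block_mat (?S * ?M) (W @\<^sub>r X) (U @\<^sub>c V) (0\<^sub>m e h)" .
  have "?L * ?C * ?R = four_block_mat (?S * ?M * ?T + (W @\<^sub>r X) * 0\<^sub>m h (m + e))
      (?S * ?M * 0\<^sub>m (m + e) h + (W @\<^sub>r X) * 1\<^sub>m h)
      ((U @\<^sub>c V) * ?T + 0\<^sub>m e h * 0\<^sub>m h (m + e)) ((U @\<^sub>c V) * 0\<^sub>m (m + e) h + 0\<^sub>m e h * 1\<^sub>m h)"
    unfolding 1
    by (rule mult_four_block_mat[OF mult_carrier_mat[OF S Mc] XW(2) UV zero_carrier_mat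
          T zero_carrier_mat zero_carrier_mat one_carrier_mat])
  also have "\<dots> = four_block_mat (?S * ?M * ?T) (W @\<^sub>r X) (V @\<^sub>c U) (0\<^sub>m e h)"
    using append_cols_mult_swap_blocks[OF U V] XW UV VU mult_carrier_mat[OF mult_carrier_mat[OF S Mc] T]
      right_mult_zero_mat[OF mult_carrier_mat[OF S Mc], of h] by simp
  also have "\<dots> = four_block_mat M22 (M21 @\<^sub>c W) (M12 @\<^sub>r V) (four_block_mat M11 X U (0\<^sub>m e h))"
    unfolding swap_blocks_four_block[OF M] by (rule three_block_regroup[OF M U V X W])
  finally show ?thesis .
qed

text \<open>The columns \<open>M12\<close>, \<open>V\<close> are \<open>- At\<close> times \<open>[E; Q]\<close>, where \<open>At\<close> is the antitriangular matrix and
  \<open>Q = - X\<^sup>-\<^sup>1 (M12 + M11 E)\<close>: the choice of \<open>E\<close> takes care of \<open>V\<close>, and \<open>Q\<close> of the rest. So the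
  Schur complement is \<open>M22 + M21 E + W Q\<close>. In the last term the inverse of \<open>X\<close> cancels because \<open>W\<close>
  is a multiple of \<open>X\<close>, giving \<open>W Q = G (M12 + M11 E)\<close>.\<close>

lemma schur_complement_block_antitriangular:
  fixes M11 :: "'a :: field poly mat"
  assumes M11: "M11 \<in> carrier_mat h e" and M12: "M12 \<in> carrier_mat h m"
    and M21: "M21 \<in> carrier_mat p e" and M22: "M22 \<in> carrier_mat p m"
    and U: "U \<in> carrier_mat e e" and X: "X \<in> carrier_mat h h"
    and uU: "unimodular U" and uX: "unimodular X"
    and E: "E \<in> carrier_mat e m" and G: "G \<in> carrier_mat p h"
    and V: "V = - (U * E)" and W: "W = - (G * X)"
  shows "M22 + - (M21 @\<^sub>c W) * mat_inv (four_block_mat M11 X U (0\<^sub>m e h)) * (M12 @\<^sub>r V)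
       = (G @\<^sub>c 1\<^sub>m p) * four_block_mat M11 M12 M21 M22 * (E @\<^sub>r 1\<^sub>m m)"
proof -
  let ?A = "four_block_mat M11 X U (0\<^sub>m e h)"
  note iX = mat_inv_unimodular[OF X uX]
  have A: "?A \<in> carrier_mat (e + h) (e + h)"
    using M11 X U by auto
  note iA = mat_inv_unimodular[OF A unimodular_block_antitriangular[OF M11 X U uX uU]]
  have Vc: "V \<in> carrier_mat e m" and Wc: "W \<in> carrier_mat p h"
    using U E G X by (auto simp: V W)
  define N where "N = M12 + M11 * E"
  define Q where "Q = - (mat_inv X * N)"
  have N: "N \<in> carrier_mat h m" and Q: "Q \<in> carrier_mat h m"
    using M11 M12 E iX by (auto simp: N_def Q_def)
  have ME: "M11 * E \<in> carrier_mat h m" "U * E \<in> carrier_mat e m" "M21 * E \<in> carrier_mat p m"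
    using M11 M21 U E by auto
  have XQ: "X * Q = - N"
    using X iX N by (simp add: Q_def assoc_mult_mat[OF X iX(1) N, symmetric] left_mult_one_mat[OF N])
  have EQ: "E @\<^sub>r Q \<in> carrier_mat (e + h) m" using E Q by auto
  have "M11 * E + X * Q = - M12"
    unfolding XQ N_def using M11 M12 E by (intro eq_matI) (auto simp del: index_mult_mat(1))
  then have "?A * (E @\<^sub>r Q) = (- M12) @\<^sub>r (- V)"
    using four_block_mult_append_rows[OF M11 X U zero_carrier_mat E Q] ME Q
    by (simp add: V)
  then have AEQ: "?A * (E @\<^sub>r Q) = - (M12 @\<^sub>r V)"
    using uminus_append_rows[OF M12 Vc] by simp
  have "M12 @\<^sub>r V = - (?A * (E @\<^sub>r Q))"
    unfolding AEQ by simp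
  also have "\<dots> = ?A * (- (E @\<^sub>r Q))"
    using A EQ M11 by simp
  finally have "mat_inv ?A * (M12 @\<^sub>r V) = mat_inv ?A * (?A * (- (E @\<^sub>r Q)))"
    by simp
  also have "\<dots> = - (E @\<^sub>r Q)"
    using assoc_mult_mat[OF iA(1) A, of "- (E @\<^sub>r Q)" m] iA EQ by simp
  finally have AB: "mat_inv ?A * (M12 @\<^sub>r V) = - (E @\<^sub>r Q)" .
  have MW: "M21 @\<^sub>c W \<in> carrier_mat p (e + h)" by (rule append_cols_carrier[OF M21 Wc])
  have MV: "M12 @\<^sub>r V \<in> carrier_mat (e + h) m"
    using carrier_append_rows[OF M12 Vc] by (simp add: add.commute)
  have "- (M21 @\<^sub>c W) * mat_inv ?A * (M12 @\<^sub>r V) = - (M21 @\<^sub>c W) * (- (E @\<^sub>r Q))"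
    using assoc_mult_mat[OF _ iA(1) MV, of "- (M21 @\<^sub>c W)" p] MW unfolding AB by simp
  also have "\<dots> = (M21 @\<^sub>c W) * (E @\<^sub>r Q)"
    using MW EQ by simp
  also have "\<dots> = M21 * E + W * Q"
    by (rule append_cols_mult_append_rows[OF M21 Wc E Q])
  also have "W * Q = G * N"
    using assoc_mult_mat[OF G X Q] G X Q N by (simp add: W XQ)
  also have "G * N = G * M12 + G * M11 * E"
    unfolding N_def mult_add_distrib_mat[OF G M12 ME(1)] assoc_mult_mat[OF G M11 E] ..
  finally have l: "- (M21 @\<^sub>c W) * mat_inv ?A * (M12 @\<^sub>r V) = M21 * E + (G * M12 + G * M11 * E)" .
  have GM: "G * M11 \<in> carrier_mat p e" "G * M12 \<in> carrier_mat p m" "G * M11 * E \<in> carrier_mat p m"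
    using G M11 M12 E by auto
  have "(G @\<^sub>c 1\<^sub>m p) * four_block_mat M11 M12 M21 M22 = (G * M11 + M21) @\<^sub>c (G * M12 + M22)"
    using append_cols_mult_four_block[OF G one_carrier_mat M11 M12 M21 M22] M21 M22 by simp
  then have "(G @\<^sub>c 1\<^sub>m p) * four_block_mat M11 M12 M21 M22 * (E @\<^sub>r 1\<^sub>m m)
      = (G * M11 + M21) * E + (G * M12 + M22)"
    using append_cols_mult_append_rows[OF add_carrier_mat[OF M21] add_carrier_mat[OF M22] E one_carrier_mat,
        of "G * M11" "G * M12"] GM M22 by simp
  also have "(G * M11 + M21) * E = G * M11 * E + M21 * E"
    by (rule add_mult_distrib_mat[OF GM(1) M21 E])
  finally show ?thesis
    unfolding l using G E M11 M12 M21 M22 by (intro eq_matI) (auto simp del: index_mult_mat(1))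
qed

section \<open>Kronecker products\<close>

lemma sum_div_mod:
  fixes f :: "nat \<Rightarrow> nat \<Rightarrow> 'a :: comm_monoid_add"
  shows "(\<Sum>k < a * b. f (k div b) (k mod b)) = (\<Sum>i<a. \<Sum>j<b. f i j)"
proof -
  have "i * b + j < a * b" if "i < a" "j < b" for i j
  proof -
    have "i * b + j < Suc i * b" using that by simp
    also have "\<dots> \<le> a * b" by (rule mult_le_mono1) (use that in simp)
    finally show ?thesis .
  qed
  then have "(\<Sum>k < a * b. f (k div b) (k mod b)) = (\<Sum>(i, j)\<in>{..<a} \<times> {..<b}. f i j)"
    by (intro sum.reindex_bij_witness[where i = "\<lambda>(i, j). i * b + j"
          and j = "\<lambda>k. (k div b, k mod b)"])
      (auto simp: less_mult_imp_div_less intro!: mod_less_divisor gr0I)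
  then show ?thesis by (simp add: sum.cartesian_product)
qed

lemma kron_dim [simp]:
  "dim_row (kron A B) = dim_row A * dim_row B" "dim_col (kron A B) = dim_col A * dim_col B"
  by (simp_all add: kron_def)

lemma kron_index:
  assumes "i < dim_row A * dim_row B" "j < dim_col A * dim_col B"
  shows "kron A B $$ (i, j)
    = A $$ (i div dim_row B, j div dim_col B) * B $$ (i mod dim_row B, j mod dim_col B)"
  using assms by (simp add: kron_def)

lemma kron_transpose: "transpose_mat (kron A B) = kron (transpose_mat A) (transpose_mat B)"
proof (rule eq_matI)
  fix i j assume "i < dim_row (kron (transpose_mat A) (transpose_mat B))"
    and "j < dim_col (kron (transpose_mat A) (transpose_mat B))"
  then have ij: "i < dim_col A * dim_col B" "j < dim_row A * dim_row B" by simp_all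
  then have "0 < dim_col B" "0 < dim_row B" by (auto intro: gr0I)
  with ij show "transpose_mat (kron A B) $$ (i, j) = kron (transpose_mat A) (transpose_mat B) $$ (i, j)"
    by (simp add: kron_index less_mult_imp_div_less)
qed simp_all

text \<open>The mixed product rule: the index of the inner sum runs over all pairs of a quotient and a
  remainder, so the sum splits into a product of two sums.\<close>

lemma kron_mult:
  fixes A :: "'a :: comm_ring_1 mat"
  assumes AC: "dim_col A = dim_row C" and BD: "dim_col B = dim_row D"
  shows "kron A B * kron C D = kron (A * C) (B * D)"
proof (rule eq_matI)
  fix i j assume "i < dim_row (kron (A * C) (B * D))" "j < dim_col (kron (A * C) (B * D))"
  then have ij: "i < dim_row A * dim_row B" "j < dim_col C * dim_col D" by simp_all
  then have pos: "0 < dim_row B" "0 < dim_col D" by (auto intro: gr0I)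
  let ?f = "\<lambda>k l. (A $$ (i div dim_row B, k) * C $$ (k, j div dim_col D))
      * (B $$ (i mod dim_row B, l) * D $$ (l, j mod dim_col D))"
  have "(kron A B * kron C D) $$ (i, j)
      = (\<Sum>k < dim_row C * dim_row D. ?f (k div dim_row D) (k mod dim_row D))"
    using ij AC BD by (auto simp: scalar_prod_def kron_index lessThan_atLeast0 ac_simps intro!: sum.cong)
  also have "\<dots> = (\<Sum>k < dim_row C. \<Sum>l < dim_row D. ?f k l)"
    by (rule sum_div_mod)
  also have "\<dots> = kron (A * C) (B * D) $$ (i, j)"
    using ij pos AC BD
    by (simp add: kron_index less_mult_imp_div_less scalar_prod_def lessThan_atLeast0 sum_product)
  finally show "(kron A B * kron C D) $$ (i, j) = kron (A * C) (B * D) $$ (i, j)" .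
qed simp_all

section \<open>The dual bases \<open>L\<^sub>k\<close> and \<open>\<Lambda>\<^sub>k\<close>\<close>

text \<open>Row \<open>i\<close> of the product is \<open>- \<lambda>\<^bsup>k - i\<^esup> + \<lambda> \<lambda>\<^bsup>k - i - 1\<^esup>\<close>.\<close>

lemma L_pencil_mult_Lambda_col: "L_pencil k * Lambda_col k = (0\<^sub>m k 1 :: 'a :: comm_ring_1 poly mat)"
proof (rule eq_matI)
  fix i j assume "i < dim_row (0\<^sub>m k 1 :: 'a poly mat)" "j < dim_col (0\<^sub>m k 1 :: 'a poly mat)"
  then have i: "i < k" and j: "j = 0" by auto
  have "(L_pencil k * Lambda_col k :: 'a poly mat) $$ (i, j)
      = (\<Sum>l < k + 1. (if l = i then -1 else if l = i + 1 then [:0, 1:] else 0) * [:0, 1:] ^ (k - l))"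
    using i j by (auto simp: L_pencil_def Lambda_col_def scalar_prod_def lessThan_atLeast0 intro!: sum.cong)
  also have "\<dots> = (\<Sum>l \<in> {i, i + 1}. (if l = i then -1 else if l = i + 1 then [:0, 1:] else 0) * [:0, 1:] ^ (k - l))"
    by (rule sum.mono_neutral_right) (use i in auto)
  also have "\<dots> = - ([:0, 1:] ^ (k - i)) + [:0, 1:] * [:0, 1:] ^ (k - (i + 1))"
    by simp
  also have "k - i = Suc (k - (i + 1))" using i by simp
  finally show "(L_pencil k * Lambda_col k :: 'a poly mat) $$ (i, j) = 0\<^sub>m k 1 $$ (i, j)"
    using i j by simp
qed (auto simp: L_pencil_def Lambda_col_def)

lemma kron_Lambda_col_split:
  obtains E where "E \<in> carrier_mat (k * n) n"
    "kron (Lambda_col k) (1\<^sub>m n) = (E @\<^sub>r 1\<^sub>m n :: 'a :: comm_ring_1 poly mat)"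
proof -
  let ?K = "kron (Lambda_col k) (1\<^sub>m n) :: 'a poly mat"
  define E where "E = mat (k * n) n (\<lambda>ij. ?K $$ ij)"
  have E: "E \<in> carrier_mat (k * n) n" by (simp add: E_def)
  have "?K = E @\<^sub>r 1\<^sub>m n"
  proof (rule eq_matI)
    fix i j assume "i < dim_row (E @\<^sub>r 1\<^sub>m n :: 'a poly mat)" "j < dim_col (E @\<^sub>r 1\<^sub>m n :: 'a poly mat)"
    then have ij: "i < k * n + n" "j < n" using E by (auto simp: append_rows_def)
    show "?K $$ (i, j) = (E @\<^sub>r 1\<^sub>m n) $$ (i, j)"
    proof (cases "i < k * n")
      case True
      then show ?thesis using ij E by (simp add: append_rows_def E_def)
    next
      case False
      define l where "l = i - k * n"
      have l: "i = k * n + l" "l < n" using False ij by (auto simp: l_def)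
      then show ?thesis
        using ij E by (simp add: append_rows_def kron_index Lambda_col_def)
    qed
  qed (use E in \<open>auto simp: append_rows_def Lambda_col_def\<close>)
  with E that show thesis by blast
qed

text \<open>The product of \<open>L\<^sub>k \<otimes> I\<^sub>n\<close> and \<open>\<Lambda>\<^sub>k \<otimes> I\<^sub>n\<close> vanishes by the mixed product rule; in block form
  it is \<open>A E + B I\<^sub>n\<close>.\<close>

lemma kron_L_pencil_split:
  fixes A B :: "'a :: field poly mat"
  assumes A: "A \<in> carrier_mat (k * n) (k * n)" and B: "B \<in> carrier_mat (k * n) n"
    and L: "kron (L_pencil k) (1\<^sub>m n) = A @\<^sub>c B"
  obtains E where "E \<in> carrier_mat (k * n) n" "kron (Lambda_col k) (1\<^sub>m n) = E @\<^sub>r 1\<^sub>m n"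
    "B = - (A * E)"
proof -
  obtain E :: "'a poly mat" where E: "E \<in> carrier_mat (k * n) n"
    and K: "kron (Lambda_col k) (1\<^sub>m n) = E @\<^sub>r 1\<^sub>m n"
    by (rule kron_Lambda_col_split)
  have "A * E + B * 1\<^sub>m n = kron (L_pencil k) (1\<^sub>m n) * kron (Lambda_col k) (1\<^sub>m n)"
    unfolding L K by (rule append_cols_mult_append_rows[symmetric, OF A B E one_carrier_mat])
  also have "\<dots> = kron (0\<^sub>m k 1) (1\<^sub>m n * 1\<^sub>m n)"
    unfolding L_pencil_mult_Lambda_col[symmetric]
    by (rule kron_mult) (auto simp: L_pencil_def Lambda_col_def)
  finally have *: "A * E + B = kron (0\<^sub>m k 1) (1\<^sub>m n)" using B by simp
  have "B = - (A * E)"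
  proof (rule eq_matI)
    fix i j assume "i < dim_row (- (A * E))" "j < dim_col (- (A * E))"
    then have ij: "i < k * n" "j < n" using A E by auto
    have "(A * E) $$ (i, j) + B $$ (i, j) = (A * E + B) $$ (i, j)"
      using ij B by simp
    also have "\<dots> = 0"
      unfolding * using ij by (simp add: kron_index less_mult_imp_div_less)
    finally show "B $$ (i, j) = (- (A * E)) $$ (i, j)"
      using ij A E by (simp add: eq_neg_iff_add_eq_0 add.commute)
  qed (use A B E in auto)
  with E K that show thesis by blast
qed

text \<open>Omitting the last \<open>n\<close> columns leaves a block bidiagonal matrix with diagonal blocks \<open>- I\<^sub>n\<close> and
  superdiagonal blocks \<open>\<lambda> I\<^sub>n\<close>.\<close>

lemma unimodular_kron_L_pencil_block:
  fixes A B :: "'a :: field poly mat"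
  assumes A: "A \<in> carrier_mat (k * n) (k * n)" and B: "B \<in> carrier_mat (k * n) n"
    and L: "kron (L_pencil k) (1\<^sub>m n) = A @\<^sub>c B"
  shows "unimodular A"
proof -
  have entry: "A $$ (i, j) = (L_pencil k :: 'a poly mat) $$ (i div n, j div n) * (if i mod n = j mod n then 1 else 0)"
    if ij: "i < k * n" "j < k * n" for i j
  proof -
    have n: "0 < n" using ij by (auto intro: gr0I)
    have "A $$ (i, j) = (A @\<^sub>c B) $$ (i, j)"
      using ij by (simp add: append_cols_index[OF A B])
    also have "\<dots> = kron (L_pencil k) (1\<^sub>m n) $$ (i, j)" using L by simp
    finally show ?thesis using ij n by (simp add: kron_index L_pencil_def)
  qed
  have ut: "upper_triangular A"
  proof (rule upper_triangularI)
    fix i j assume ji: "j < i" and "i < dim_row A"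
    then have i: "i < k * n" using A by simp
    then have n: "0 < n" by (auto intro: gr0I)
    have div: "j div n \<le> i div n" using ji by (simp add: div_le_mono)
    \<comment> \<open>Inside a diagonal block, \<open>I\<^sub>n\<close> vanishes off the diagonal; below the diagonal blocks, \<open>L\<^sub>k\<close> vanishes.\<close>
    have "i mod n \<noteq> j mod n" if "i div n = j div n"
      using that ji by (metis div_mult_mod_eq less_irrefl)
    then show "A $$ (i, j) = 0"
      using i ji n div entry[of i j]
      by (auto simp: L_pencil_def less_mult_imp_div_less)
  qed
  have "diag_mat A = replicate (k * n) (- 1)"
    using A entry by (auto simp: diag_mat_def L_pencil_def less_mult_imp_div_less
        intro!: nth_equalityI)
  then have "det A = (- 1) ^ (k * n)"
    using det_upper_triangular[OF ut A] by simp
  also have "\<dots> = [:(- 1) ^ (k * n):]"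
    by (simp add: poly_const_pow one_pCons)
  finally show ?thesis
    using A by (auto simp: unimodular_def)
qed

section \<open>The extended block Kronecker pencil\<close>

lemma degree_L_pencil_kron_le:
  assumes "i < k * n" "j < (k + 1) * n"
  shows "degree (kron (L_pencil k) (1\<^sub>m n :: 'a :: comm_ring_1 poly mat) $$ (i, j)) \<le> 1"
proof -
  have "0 < n" using assms by (auto intro: gr0I)
  with assms show ?thesis
    by (auto simp: kron_index L_pencil_def less_mult_imp_div_less)
qed

lemma degree_const_mat_mult_le:
  fixes Y :: "'a :: comm_ring_1 mat"
  assumes Y: "Y \<in> carrier_mat r n" and K: "K \<in> carrier_mat n c" and ij: "i < r" "j < c"
    and deg: "\<And>l. l < n \<Longrightarrow> degree (K $$ (l, j)) \<le> 1"
  shows "degree ((const_mat Y * K) $$ (i, j)) \<le> 1"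
proof -
  have "(const_mat Y * K) $$ (i, j) = (\<Sum>l<n. [:Y $$ (i, l):] * K $$ (l, j))"
    using Y K ij by (auto simp: const_mat_def scalar_prod_def lessThan_atLeast0 intro!: sum.cong)
  also have "degree \<dots> \<le> 1"
  proof (rule degree_sum_le)
    fix l assume "l \<in> {..<n}"
    then show "degree ([:Y $$ (i, l):] * K $$ (l, j)) \<le> 1"
      using degree_smult_le[of "Y $$ (i, l)" "K $$ (l, j)"] deg[of l] by simp
  qed simp
  finally show ?thesis .
qed

lemma is_pencil_extended_block_kronecker:
  fixes M1 M0 Y Z :: "'a :: field mat"
  assumes M1: "M1 \<in> carrier_mat ((\<eta> + 1) * p) ((\<epsilon> + 1) * m)"
    and M0: "M0 \<in> carrier_mat ((\<eta> + 1) * p) ((\<epsilon> + 1) * m)"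
    and Y: "Y \<in> carrier_mat (\<epsilon> * m) (\<epsilon> * m)" and Z: "Z \<in> carrier_mat (\<eta> * p) (\<eta> * p)"
  shows "is_pencil (extended_block_kronecker \<epsilon> \<eta> p m M1 M0 Y Z)"
proof -
  let ?K = "\<lambda>k n. kron (L_pencil k) (1\<^sub>m n) :: 'a poly mat"
  have K: "?K k n \<in> carrier_mat (k * n) ((k + 1) * n)" for k n
    by (rule carrier_matI) (simp_all add: L_pencil_def)
  have dM: "degree (pencil M1 M0 $$ (i, j)) \<le> 1"
    if "i < (\<eta> + 1) * p" "j < (\<epsilon> + 1) * m" for i j
    using that M1 M0 by (simp add: pencil_def const_mat_def)
  have dK: "degree ((const_mat W * ?K k n) $$ (i, j)) \<le> 1"
    if "W \<in> carrier_mat (k * n) (k * n)" "i < k * n" "j < (k + 1) * n" for W k n i j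
    by (rule degree_const_mat_mult_le[OF that(1) K that(2,3)])
      (rule degree_L_pencil_kron_le[OF _ that(3)])
  have dims: "dim_row (pencil M1 M0) = (\<eta> + 1) * p" "dim_col (pencil M1 M0) = (\<epsilon> + 1) * m"
    "dim_row (const_mat Y) = \<epsilon> * m" "dim_row (const_mat Z) = \<eta> * p"
    "dim_col (?K k n) = (k + 1) * n" for k n
    using M1 M0 Y Z K[of k n] by (auto simp: pencil_def const_mat_def)
  show ?thesis
    unfolding is_pencil_def extended_block_kronecker_def
    using dM dK[OF Y] dK[OF Z] by (auto simp: dims simp del: kron_dim)
qed

theorem theorem7p2:
  fixes \<epsilon> \<eta> p m :: nat
    and M1 M0 Y Z :: "'a :: field mat"
    and P C_EK A\<^sub>\<epsilon> B\<^sub>\<epsilon> A\<^sub>\<eta> B\<^sub>\<eta> M11 M12 M21 M22 :: "'a poly mat"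
    and At Bt Ct Dt :: "'a poly mat"
  assumes p: "p \<ge> 1" and m: "m \<ge> 1"
    and M1: "M1 \<in> carrier_mat ((\<eta> + 1) * p) ((\<epsilon> + 1) * m)"
    and M0: "M0 \<in> carrier_mat ((\<eta> + 1) * p) ((\<epsilon> + 1) * m)"
    and Y: "Y \<in> carrier_mat (\<epsilon> * m) (\<epsilon> * m)"
    and Z: "Z \<in> carrier_mat (\<eta> * p) (\<eta> * p)"
  defines "C_EK \<equiv> extended_block_kronecker \<epsilon> \<eta> p m M1 M0 Y Z"
    and "P \<equiv> kron (transpose_mat (Lambda_col \<eta>)) (1\<^sub>m p) * pencil M1 M0
               * kron (Lambda_col \<epsilon>) (1\<^sub>m m)"
  assumes A\<^sub>\<epsilon>: "A\<^sub>\<epsilon> \<in> carrier_mat (\<epsilon> * m) (\<epsilon> * m)"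
    and B\<^sub>\<epsilon>: "B\<^sub>\<epsilon> \<in> carrier_mat (\<epsilon> * m) m"
    and L\<^sub>\<epsilon>: "kron (L_pencil \<epsilon>) (1\<^sub>m m) = A\<^sub>\<epsilon> @\<^sub>c B\<^sub>\<epsilon>"
    and A\<^sub>\<eta>: "A\<^sub>\<eta> \<in> carrier_mat (\<eta> * p) (\<eta> * p)"
    and B\<^sub>\<eta>: "B\<^sub>\<eta> \<in> carrier_mat (\<eta> * p) p"
    and L\<^sub>\<eta>: "kron (L_pencil \<eta>) (1\<^sub>m p) = A\<^sub>\<eta> @\<^sub>c B\<^sub>\<eta>"
    and M11: "M11 \<in> carrier_mat (\<eta> * p) (\<epsilon> * m)"
    and M12: "M12 \<in> carrier_mat (\<eta> * p) m"
    and M21: "M21 \<in> carrier_mat p (\<epsilon> * m)"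
    and M22: "M22 \<in> carrier_mat p m"
    and M: "pencil M1 M0 = four_block_mat M11 M12 M21 M22"
  defines "At \<equiv> four_block_mat
                  M11                  (transpose_mat A\<^sub>\<eta> * transpose_mat (const_mat Z))
                  (const_mat Y * A\<^sub>\<epsilon>)   (0\<^sub>m (\<epsilon> * m) (\<eta> * p))"
    and "Bt \<equiv> M12 @\<^sub>r (const_mat Y * B\<^sub>\<epsilon>)"
    and "Ct \<equiv> - (M21 @\<^sub>c (transpose_mat B\<^sub>\<eta> * transpose_mat (const_mat Z)))"
    and "Dt \<equiv> M22"
  assumes Y_inv: "invertible_mat Y" and Z_inv: "invertible_mat Z"
  shows "unimodular At
       \<and> Dt + Ct * mat_inv At * Bt = P
       \<and> is_linearization C_EK P"
proof -
  let ?h = "\<eta> * p" and ?e = "\<epsilon> * m"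
  let ?Y = "const_mat Y" and ?Z = "const_mat Z"
  define U where "U = ?Y * A\<^sub>\<epsilon>"
  define V where "V = ?Y * B\<^sub>\<epsilon>"
  define X where "X = transpose_mat A\<^sub>\<eta> * transpose_mat ?Z"
  define W where "W = transpose_mat B\<^sub>\<eta> * transpose_mat ?Z"
  have Yc: "?Y \<in> carrier_mat ?e ?e" and Zc: "?Z \<in> carrier_mat ?h ?h"
    using Y Z by (simp_all add: const_mat_def)
  have U: "U \<in> carrier_mat ?e ?e" and V: "V \<in> carrier_mat ?e m"
    and X: "X \<in> carrier_mat ?h ?h" and W: "W \<in> carrier_mat p ?h"
    using Yc Zc A\<^sub>\<epsilon> B\<^sub>\<epsilon> A\<^sub>\<eta> B\<^sub>\<eta> by (auto simp: U_def V_def X_def W_def)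
  have uU: "unimodular U"
    unfolding U_def
    by (rule unimodular_mult[OF Yc A\<^sub>\<epsilon> unimodular_const_mat[OF Y Y_inv]
          unimodular_kron_L_pencil_block[OF A\<^sub>\<epsilon> B\<^sub>\<epsilon> L\<^sub>\<epsilon>]])
  have uX: "unimodular X"
    unfolding X_def transpose_mult[OF Zc A\<^sub>\<eta>, symmetric]
    by (rule unimodular_transpose[OF mult_carrier_mat[OF Zc A\<^sub>\<eta>]
          unimodular_mult[OF Zc A\<^sub>\<eta> unimodular_const_mat[OF Z Z_inv]
            unimodular_kron_L_pencil_block[OF A\<^sub>\<eta> B\<^sub>\<eta> L\<^sub>\<eta>]]])
  obtain E where E: "E \<in> carrier_mat ?e m"
    and \<Lambda>\<^sub>\<epsilon>: "kron (Lambda_col \<epsilon>) (1\<^sub>m m) = E @\<^sub>r 1\<^sub>m m" and B\<^sub>\<epsilon>_eq: "B\<^sub>\<epsilon> = - (A\<^sub>\<epsilon> * E)"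
    by (rule kron_L_pencil_split[OF A\<^sub>\<epsilon> B\<^sub>\<epsilon> L\<^sub>\<epsilon>])
  obtain F where F: "F \<in> carrier_mat ?h p"
    and \<Lambda>\<^sub>\<eta>: "kron (Lambda_col \<eta>) (1\<^sub>m p) = F @\<^sub>r 1\<^sub>m p" and B\<^sub>\<eta>_eq: "B\<^sub>\<eta> = - (A\<^sub>\<eta> * F)"
    by (rule kron_L_pencil_split[OF A\<^sub>\<eta> B\<^sub>\<eta> L\<^sub>\<eta>])
  define G where "G = transpose_mat F"
  have G: "G \<in> carrier_mat p ?h" using F by (simp add: G_def)
  have V_eq: "V = - (U * E)"
    unfolding V_def U_def B\<^sub>\<epsilon>_eq using assoc_mult_mat[OF Yc A\<^sub>\<epsilon> E] Yc A\<^sub>\<epsilon> E by simp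
  have "transpose_mat B\<^sub>\<eta> = - (G * transpose_mat A\<^sub>\<eta>)"
    unfolding B\<^sub>\<eta>_eq G_def using transpose_mult[OF A\<^sub>\<eta> F] by (simp add: transpose_uminus)
  then have W_eq: "W = - (G * X)"
    unfolding W_def X_def using assoc_mult_mat[OF G, of "transpose_mat A\<^sub>\<eta>" ?h "transpose_mat ?Z" ?h]
      A\<^sub>\<eta> Zc G by simp
  have "kron (transpose_mat (Lambda_col \<eta>)) (1\<^sub>m p) = transpose_mat (kron (Lambda_col \<eta>) (1\<^sub>m p) :: 'a poly mat)"
    by (simp add: kron_transpose)
  also have "\<dots> = G @\<^sub>c 1\<^sub>m p"
    unfolding \<Lambda>\<^sub>\<eta> G_def
    using transpose_append_cols[of G p ?h "1\<^sub>m p" p] G F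
    by (metis G_def append_cols_carrier one_carrier_mat transpose_one transpose_transpose)
  finally have P: "P = (G @\<^sub>c 1\<^sub>m p) * four_block_mat M11 M12 M21 M22 * (E @\<^sub>r 1\<^sub>m m)"
    unfolding P_def \<Lambda>\<^sub>\<epsilon> M by simp
  have At: "At = four_block_mat M11 X U (0\<^sub>m ?e ?h)" and Bt: "Bt = M12 @\<^sub>r V"
    and Ct: "Ct = - (M21 @\<^sub>c W)"
    by (simp_all add: At_def Bt_def Ct_def U_def V_def X_def W_def)
  have a: "unimodular At"
    unfolding At by (rule unimodular_block_antitriangular[OF M11 X U uX uU])
  have b: "Dt + Ct * mat_inv At * Bt = P"
    unfolding At Bt Ct Dt_def P
    by (rule schur_complement_block_antitriangular[OF M11 M12 M21 M22 U X uU uX E G V_eq W_eq])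

  \<comment> \<open>In \<open>C_EK\<close> the blocks are still in their original order; \<open>?L\<close> and \<open>?R\<close> bring \<open>Dt\<close> to the front.\<close>
  have C_eq: "C_EK = four_block_mat (four_block_mat M11 M12 M21 M22) (X @\<^sub>r W) (U @\<^sub>c V) (0\<^sub>m ?e ?h)"
    unfolding C_EK_def extended_block_kronecker_def M L\<^sub>\<epsilon> L\<^sub>\<eta>
      mult_append_cols[OF Yc A\<^sub>\<epsilon> B\<^sub>\<epsilon>] mult_append_cols[OF Zc A\<^sub>\<eta> B\<^sub>\<eta>]
      transpose_append_cols[OF mult_carrier_mat[OF Zc A\<^sub>\<eta>] mult_carrier_mat[OF Zc B\<^sub>\<eta>]]
      transpose_mult[OF Zc A\<^sub>\<eta>] transpose_mult[OF Zc B\<^sub>\<eta>]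
    by (simp add: U_def V_def X_def W_def)
  let ?L = "four_block_mat (swap_blocks_mat ?h p) (0\<^sub>m (?h + p) ?e) (0\<^sub>m ?e (?h + p)) (1\<^sub>m ?e) :: 'a poly mat"
  let ?R = "four_block_mat (swap_blocks_mat m ?e) (0\<^sub>m (m + ?e) ?h) (0\<^sub>m ?h (m + ?e)) (1\<^sub>m ?h) :: 'a poly mat"
  let ?n = "?h + ?e"
  have Lc: "?L \<in> carrier_mat (p + ?n) (p + ?n)" and Rc: "?R \<in> carrier_mat (m + ?n) (m + ?n)"
    using swap_blocks_mat_carrier[of ?h p, where 'a = "'a poly"]
      swap_blocks_mat_carrier[of m ?e, where 'a = "'a poly"]
    by (auto intro!: carrier_matI)
  have uL: "unimodular ?L" and uR: "unimodular ?R"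
    by (rule unimodular_diag_block[OF swap_blocks_mat_carrier unimodular_swap_blocks_mat])+
  have Cc: "C_EK \<in> carrier_mat (p + ?n) (m + ?n)"
    unfolding C_eq using M11 M22 by (auto intro!: carrier_matI)
  have swapped: "?L * C_EK * ?R = four_block_mat Dt (- Ct) Bt At"
    unfolding C_eq At Bt Ct Dt_def using swap_three_block_matrix[OF M11 M12 M21 M22 U V X W] by simp
  have car: "At \<in> carrier_mat ?n ?n" "Bt \<in> carrier_mat ?n m" "Ct \<in> carrier_mat p ?n"
    "Dt \<in> carrier_mat p m"
    unfolding At Bt Ct Dt_def
    using M22 four_block_carrier_mat[OF M11 zero_carrier_mat, of X U ?e ?h]
      carrier_append_rows[OF M12 V] append_cols_carrier[OF M21 W]
    by (simp_all add: add.commute)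
  obtain U' V' where U': "U' \<in> carrier_mat (p + ?n) (p + ?n)" "unimodular U'"
    and V': "V' \<in> carrier_mat (m + ?n) (m + ?n)" "unimodular V'"
    and eq: "U' * four_block_mat Dt (- Ct) Bt At * V'
      = four_block_mat (Dt + Ct * mat_inv At * Bt) (0\<^sub>m p ?n) (0\<^sub>m ?n m) (1\<^sub>m ?n)"
    by (rule schur_complement_equivalence[OF car a])
  have "U' * ?L * C_EK * (?R * V') = U' * (?L * C_EK * ?R) * V'"
    using assoc_mult_mat[OF U'(1) Lc Cc] assoc_mult_mat[OF U'(1) mult_carrier_mat[OF Lc Cc] Rc]
      assoc_mult_mat[OF mult_carrier_mat[OF U'(1) mult_carrier_mat[OF Lc Cc]] Rc V'(1)] by simp
  then have eq': "U' * ?L * C_EK * (?R * V') = four_block_mat P (0\<^sub>m p ?n) (0\<^sub>m ?n m) (1\<^sub>m ?n)"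
    unfolding swapped eq b .
  have dimP: "dim_row P = p" "dim_col P = m"
    using car by (auto simp flip: b)
  have "is_pencil C_EK"
    unfolding C_EK_def by (rule is_pencil_extended_block_kronecker[OF M1 M0 Y Z])
  moreover have "U' * ?L \<in> carrier_mat (dim_row C_EK) (dim_row C_EK)"
    "?R * V' \<in> carrier_mat (dim_col C_EK) (dim_col C_EK)"
    using mult_carrier_mat[OF U'(1) Lc] mult_carrier_mat[OF Rc V'(1)] Cc by auto
  moreover have "unimodular (U' * ?L)" "unimodular (?R * V')"
    by (rule unimodular_mult[OF U'(1) Lc U'(2) uL], rule unimodular_mult[OF Rc V'(1) uR V'(2)])
  ultimately have "is_linearization C_EK P"
    unfolding is_linearization_def using eq' dimP by blast
  with a b show ?thesis by blast
qed

end
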